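(* Let $\mathcal{T}=\{1,\dots,T\}$, let $\mathcal{I}=\bigcup_{t\in\mathcal{T}}\mathcal{I}_t$ be a partition of a finite index set into nonempty disjoint subsets, and let $N_t=|\mathcal{I}_t|$. Let $\mathcal{L}$ be a finite index set, $\mathbf{c}_t,\mathbf{a}_{tl}\in\mathbb{R}^d$ and $b_l\in\mathbb{R}$ for $t\in\mathcal{T}$, $l\in\mathcal{L}$. For each $t\in\mathcal{T}$ let $$\Omega_t=\left\{(\mathbf{x},\mathbf{y})\in\mathbb{R}^{d+k}\ \middle|\ h_{tl}(\mathbf{x}_s,y^s)\le d_{tl}\ (l\in\mathcal{H}_{ts},\ s\in\mathcal{K}),\ \mathbf{x}=\{\mathbf{x}_s\}_{s\in\mathcal{K}},\ \mathbf{A}_t\mathbf{y}\le\mathbf{b}_t,\ \mathbf{y}\in\{0,1\}^k\right\}$$ be bounded, where $\mathcal{K}=\{1,\dots,k\}$, each $\mathcal{H}_{ts}$ is a finite index set, each $h_{tl}$ is a closed convex function of $(\mathbf{x}_s,y^s)$, $d_{tl}\in\mathbb{R}$, $\mathbf{A}_t$ is totally unimodular, $\mathbf{b}_t$ is an integer vector, and $\{\mathbf{y}\in\mathbb{R}^k\mid\mathbf{A}_t\mathbf{y}\le\mathbf{b}_t\}\subseteq[0,1]^k$. Let $\mathrm{LB}_{(\mathrm{P0})}$, $\mathrm{LB}_{(\mathrm{P\text{-}per})}$, $\mathrm{LB}_{(\mathrm{P\text{-}agg})}$ be the optimal values of the three continuous relaxations defined in the context. Then $$\mathrm{LB}_{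(\mathrm{P\text{-}agg})}=\mathrm{LB}_{(\mathrm{P\text{-}per})}\ge\mathrm{LB}_{(\mathrm{P0})}.$$
   Context: The vector $\mathbf{x}\in\mathbb{R}^d$ is partitioned into subvectors $\mathbf{x}_s$ ($s\in\mathcal{K}$), written $\mathbf{x}=\{\mathbf{x}_s\}_{s\in\mathcal{K}}$ (concatenation); $y^s$ is the $s$-th entry of $\mathbf{y}$. The same partition is used for $\mathbf{X}$. Closed convex functions are real-valued on a closed convex effective domain and $+\infty$ outside it. The perspective function of such a function $f$ with effective domain $\mathcal{F}$ is $F(\mathbf{x},\tau)=\tau f(\mathbf{x}/\tau)$ if $\tau>0$ and $\mathbf{x}/\tau\in\mathcal{F}$; $F(\mathbf{x},\tau)=0$ if $\tau=0$ and $\mathbf{x}=\mathbf{0}$; $F(\mathbf{x},\tau)=+\infty$ otherwise. For $l\in\mathcal{H}_{ts}$ let $\hat H_{tl}$ and $\bar H_{tl}$ be the perspective functions of $\hat h_{tl}(\mathbf{x}_s)=h_{tl}(\mathbf{x}_s,1)$ and $\bar h_{tl}(\mathbf{x}_s)=h_{tl}(\mathbf{x}_s,0)$, respectively. For each $t\in\mathcal{T}$ define: (1) $\mathcal{C}_t=\{(\mathbf{x},\mathbf{y})\in\mathbb{R}^{d+k}\mid h_{tl}(\mathbf{x}_s,y^s)\le d_{tl}\ (l\in\mathcal{H}_{ts},\ s\in\mathcal{K}),\ \mathbf{x}=\{\mathbf{x}_s\}_{s\in\mathcal{K}},\ \mathbf{A}_t\mathbf{y}\le\mathbf{b}_t\}$.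 (2) $\tilde\Omega_t^{\mathrm{per}}$: the set of $(\mathbf{x},\mathbf{y})\in\mathbb{R}^{d+k}$ with $\mathbf{A}_t\mathbf{y}\le\mathbf{b}_t$ for which there exist $\mathbf{w}_s,\mathbf{z}_s$ ($s\in\mathcal{K}$) with $\mathbf{x}_s=\mathbf{w}_s+\mathbf{z}_s$, $\hat H_{tl}(\mathbf{w}_s,y^s)\le y^s d_{tl}$ and $\bar H_{tl}(\mathbf{z}_s,1-y^s)\le(1-y^s)d_{tl}$ for all $l\in\mathcal{H}_{ts}$, $s\in\mathcal{K}$. (3) $\tilde\Omega_t^{\mathrm{agg}}$: the set of $(\mathbf{X},\mathbf{Y})\in\mathbb{R}^{d+k}$ with $\mathbf{A}_t\mathbf{Y}\le N_t\mathbf{b}_t$ for which there exist $\mathbf{W}_s,\mathbf{Z}_s$ ($s\in\mathcal{K}$) with $\mathbf{X}_s=\mathbf{W}_s+\mathbf{Z}_s$, $\hat H_{tl}(\mathbf{W}_s,Y^s)\le Y^s d_{tl}$ and $\bar H_{tl}(\mathbf{Z}_s,N_t-Y^s)\le(N_t-Y^s)d_{tl}$ for all $l\in\mathcal{H}_{ts}$, $s\in\mathcal{K}$. The three relaxations and their optimal values (infima in $\mathbb{R}\cup\{\pm\infty\}$, with value $+\infty$ for an infeasible problem): - $\mathrm{LB}_{(\mathrm{P0})}$: minimize $\sum_{t\in\mathcal{T}}\sum_{i\in\mathcal{I}_t}\mathbf{c}_t^\top\mathbf{x}_i$ subject to $\sum_{t\in\mathcal{T}}\sum_{i\in\mathcal{I}_t}\mathbf{a}_{tl}^\top\mathbf{x}_i\le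 b_l$ for $l\in\mathcal{L}$, and $(\mathbf{x}_i,\mathbf{y}_i)\in\mathcal{C}_t$ for $i\in\mathcal{I}_t$, $t\in\mathcal{T}$. - $\mathrm{LB}_{(\mathrm{P\text{-}per})}$: the same problem with $\mathcal{C}_t$ replaced by $\tilde\Omega_t^{\mathrm{per}}$. - $\mathrm{LB}_{(\mathrm{P\text{-}agg})}$: minimize $\sum_{t\in\mathcal{T}}\mathbf{c}_t^\top\mathbf{X}_t$ subject to $\sum_{t\in\mathcal{T}}\mathbf{a}_{tl}^\top\mathbf{X}_t\le b_l$ for $l\in\mathcal{L}$, and $(\mathbf{X}_t,\mathbf{Y}_t)\in\tilde\Omega_t^{\mathrm{agg}}$ for $t\in\mathcal{T}$. *)

theory Defs
  imports "HOL-Analysis.Analysis" "Jordan_Normal_Form.Determinant"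
begin

no_notation Matrix.vec_index (infixl "$" 100)
no_notation Matrix.scalar_prod (infix "\<bullet>" 70)

(* The partition of the d coordinates into k blocks is a map blk sending a coordinate to its
   block.  A subvector x_s is identified with the vector of R^d that agrees with x on block s
   and vanishes elsewhere, so that R^{d_s} becomes the coordinate subspace block_space blk s. *)

definition block_space :: "('d \<Rightarrow> 'k) \<Rightarrow> 'k \<Rightarrow> (real ^ 'd) set" where
  "block_space blk s = {v. \<forall>j. blk j \<noteq> s \<longrightarrow> v $ j = 0}"

definition subvec :: "('d \<Rightarrow> 'k) \<Rightarrow> 'k \<Rightarrow> real ^ 'd \<Rightarrow> real ^ 'd" where
  "subvec blk s x = (\<chi> j. if blk j = s then x $ j else 0)"

definition eff_domain :: "'a set \<Rightarrow> ('a \<Rightarrow> ereal) \<Rightarrow> 'a set" where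
  "eff_domain S f = {x \<in> S. f x \<noteq> \<infinity>}"

(* f is only regarded as a function on the closed subspace S; its values off S are irrelevant. *)

definition closed_convex_function :: "'a::euclidean_space set \<Rightarrow> ('a \<Rightarrow> ereal) \<Rightarrow> bool" where
  "closed_convex_function S f \<longleftrightarrow>
     (\<forall>x\<in>S. f x \<noteq> -\<infinity>) \<and>
     closed (eff_domain S f) \<and>
     convex_on (eff_domain S f) (\<lambda>x. real_of_ereal (f x)) \<and>
     closed (epigraph (eff_domain S f) (\<lambda>x. real_of_ereal (f x)))"

definition perspective :: "('a::real_vector \<Rightarrow> ereal) \<Rightarrow> 'a \<Rightarrow> real \<Rightarrow> ereal" where
  "perspective f x \<tau> =
     (if \<tau> > 0 \<and> x /\<^sub>R \<tau> \<in> eff_domain UNIV f then ereal \<tau> * f (x /\<^sub>R \<tau>)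
      else if \<tau> = 0 \<and> x = 0 then 0
      else \<infinity>)"

(* A matrix with m rows and columns indexed by 'k is given by its rows A 0, ..., A (m - 1).
   Letting f and g enumerate the chosen rows and columns in any order changes the
   determinant at most by its sign. *)

definition totally_unimodular :: "nat \<Rightarrow> (nat \<Rightarrow> real ^ 'k) \<Rightarrow> bool" where
  "totally_unimodular m A \<longleftrightarrow>
     (\<forall>n (f :: nat \<Rightarrow> nat) (g :: nat \<Rightarrow> 'k).
        f ` {..<n} \<subseteq> {..<m} \<and> inj_on f {..<n} \<and> inj_on g {..<n} \<longrightarrow>
        Determinant.det (Matrix.mat n n (\<lambda>(i, j). A (f i) $ g j)) \<in> {-1, 0, 1})"

definition lin_ineqs :: "nat \<Rightarrow> (nat \<Rightarrow> real ^ 'k) \<Rightarrow> (nat \<Rightarrow> real) \<Rightarrow> (real ^ 'k) set" where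
  "lin_ineqs m A r = {y. \<forall>i<m. A i \<bullet> y \<le> r i}"

definition C_set ::
  "('d \<Rightarrow> 'k) \<Rightarrow> ('k \<Rightarrow> 'm set) \<Rightarrow> ('m \<Rightarrow> (real ^ 'd) \<times> real \<Rightarrow> ereal) \<Rightarrow> ('m \<Rightarrow> real) \<Rightarrow>
   nat \<Rightarrow> (nat \<Rightarrow> real ^ 'k) \<Rightarrow> (nat \<Rightarrow> real) \<Rightarrow> ((real ^ 'd) \<times> (real ^ 'k)) set" where
  "C_set blk H h \<delta> m A r =
     {(x, y). (\<forall>s. \<forall>l\<in>H s. h l (subvec blk s x, y $ s) \<le> ereal (\<delta> l)) \<and>
              y \<in> lin_ineqs m A r}"

definition Omega_set ::
  "('d \<Rightarrow> 'k) \<Rightarrow> ('k \<Rightarrow> 'm set) \<Rightarrow> ('m \<Rightarrow> (real ^ 'd) \<times> real \<Rightarrow> ereal) \<Rightarrow> ('m \<Rightarrow> real) \<Rightarrow>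
   nat \<Rightarrow> (nat \<Rightarrow> real ^ 'k) \<Rightarrow> (nat \<Rightarrow> real) \<Rightarrow> ((real ^ 'd) \<times> (real ^ 'k)) set" where
  "Omega_set blk H h \<delta> m A r =
     {(x, y). (\<forall>s. \<forall>l\<in>H s. h l (subvec blk s x, y $ s) \<le> ereal (\<delta> l)) \<and>
              y \<in> lin_ineqs m A r \<and> (\<forall>s. y $ s \<in> {0, 1})}"

definition per_set ::
  "('d \<Rightarrow> 'k) \<Rightarrow> ('k \<Rightarrow> 'm set) \<Rightarrow> ('m \<Rightarrow> (real ^ 'd) \<times> real \<Rightarrow> ereal) \<Rightarrow> ('m \<Rightarrow> real) \<Rightarrow>
   nat \<Rightarrow> (nat \<Rightarrow> real ^ 'k) \<Rightarrow> (nat \<Rightarrow> real) \<Rightarrow> ((real ^ 'd) \<times> (real ^ 'k)) set" where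
  "per_set blk H h \<delta> m A r =
     {(x, y). y \<in> lin_ineqs m A r \<and>
        (\<exists>w z. \<forall>s. w s \<in> block_space blk s \<and> z s \<in> block_space blk s \<and>
           subvec blk s x = w s + z s \<and>
           (\<forall>l\<in>H s.
              perspective (\<lambda>v. h l (v, 1)) (w s) (y $ s) \<le> ereal (y $ s * \<delta> l) \<and>
              perspective (\<lambda>v. h l (v, 0)) (z s) (1 - y $ s) \<le> ereal ((1 - y $ s) * \<delta> l)))}"

definition agg_set ::
  "('d \<Rightarrow> 'k) \<Rightarrow> ('k \<Rightarrow> 'm set) \<Rightarrow> ('m \<Rightarrow> (real ^ 'd) \<times> real \<Rightarrow> ereal) \<Rightarrow> ('m \<Rightarrow> real) \<Rightarrow>
   nat \<Rightarrow> (nat \<Rightarrow> real ^ 'k) \<Rightarrow> (nat \<Rightarrow> real) \<Rightarrow> nat \<Rightarrow> ((real ^ 'd) \<times> (real ^ 'k)) set" where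
  "agg_set blk H h \<delta> m A r N =
     {(X, Y). Y \<in> lin_ineqs m A (\<lambda>i. real N * r i) \<and>
        (\<exists>W Z. \<forall>s. W s \<in> block_space blk s \<and> Z s \<in> block_space blk s \<and>
           subvec blk s X = W s + Z s \<and>
           (\<forall>l\<in>H s.
              perspective (\<lambda>v. h l (v, 1)) (W s) (Y $ s) \<le> ereal (Y $ s * \<delta> l) \<and>
              perspective (\<lambda>v. h l (v, 0)) (Z s) (real N - Y $ s)
                \<le> ereal ((real N - Y $ s) * \<delta> l)))}"

(* The infimum over the empty set is \<infinity> in ereal, as wanted for an infeasible problem. *)

definition LB_individual ::
  "nat \<Rightarrow> (nat \<Rightarrow> 'i set) \<Rightarrow> 'l set \<Rightarrow> (nat \<Rightarrow> real ^ 'd) \<Rightarrow> (nat \<Rightarrow> 'l \<Rightarrow> real ^ 'd) \<Rightarrow>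
   ('l \<Rightarrow> real) \<Rightarrow> (nat \<Rightarrow> ((real ^ 'd) \<times> (real ^ 'k)) set) \<Rightarrow> ereal" where
  "LB_individual T I L c a b S =
     Inf {ereal (\<Sum>t=1..T. \<Sum>i\<in>I t. c t \<bullet> x i) | x y.
            (\<forall>l\<in>L. (\<Sum>t=1..T. \<Sum>i\<in>I t. a t l \<bullet> x i) \<le> b l) \<and>
            (\<forall>t\<in>{1..T}. \<forall>i\<in>I t. (x i, y i) \<in> S t)}"

definition LB_aggregate ::
  "nat \<Rightarrow> 'l set \<Rightarrow> (nat \<Rightarrow> real ^ 'd) \<Rightarrow> (nat \<Rightarrow> 'l \<Rightarrow> real ^ 'd) \<Rightarrow>
   ('l \<Rightarrow> real) \<Rightarrow> (nat \<Rightarrow> ((real ^ 'd) \<times> (real ^ 'k)) set) \<Rightarrow> ereal" where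
  "LB_aggregate T L c a b S =
     Inf {ereal (\<Sum>t=1..T. c t \<bullet> X t) | X Y.
            (\<forall>l\<in>L. (\<Sum>t=1..T. a t l \<bullet> X t) \<le> b l) \<and>
            (\<forall>t\<in>{1..T}. (X t, Y t) \<in> S t)}"

definition LB_P0 where
  "LB_P0 T I L c a b blk H h \<delta> m A r =
     LB_individual T I L c a b (\<lambda>t. C_set blk (H t) (h t) (\<delta> t) (m t) (A t) (r t))"

definition LB_P_per where
  "LB_P_per T I L c a b blk H h \<delta> m A r =
     LB_individual T I L c a b (\<lambda>t. per_set blk (H t) (h t) (\<delta> t) (m t) (A t) (r t))"

definition LB_P_agg where
  "LB_P_agg T I L c a b blk H h \<delta> m A r =
     LB_aggregate T L c a b
       (\<lambda>t. agg_set blk (H t) (h t) (\<delta> t) (m t) (A t) (r t) (card (I t)))"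

end

(* Each constraint of the perspective relaxations says that (w, y) lies in the cone generated by
   K x {1}, where K is a convex sublevel set.  Such a cone is closed under addition, so summing
   the solutions of group t aggregates them, and under scaling, so conversely giving every
   member of group t the average (X_t / N_t, Y_t / N_t) disaggregates without changing the
   objective or the linking constraints.  The bound by (P0) is convexity of h_tl between
   y = 0 and y = 1. *)

theory Submission
  imports Defs
begin

text \<open>For \<open>\<tau> > 0\<close> the factor \<open>\<tau>\<close> cancels, and leaving the
  effective domain makes both sides false. For \<open>\<tau> = 0\<close> only the origin survives,
  and \<open>\<tau> < 0\<close> gives the value \<infinity>. This is the cone description on which
  the later arguments rest.\<close>

lemma perspective_le_iff:
  "perspective f w \<tau> \<le> ereal (\<tau> * \<delta>) \<longleftrightarrow>
     \<tau> > 0 \<and> f (w /\<^sub>R \<tau>) \<le> ereal \<delta> \<or> \<tau> = 0 \<and> w = 0"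
proof (cases "\<tau> > 0")
  case True
  then show ?thesis
    by (cases "f (w /\<^sub>R \<tau>)") (auto simp: perspective_def eff_domain_def)
qed (auto simp: perspective_def)

text \<open>A finite bound on \<open>f x\<close> forces \<open>x\<close> into the effective domain,
  so the extended-real sublevel set is a sublevel set of the real-valued convex function
  there.\<close>

lemma convex_sublevel:
  assumes "closed_convex_function S f"
  shows "convex {x \<in> S. f x \<le> ereal \<delta>}"
proof -
  let ?D = "eff_domain S f"
  have fin: "f x = ereal (real_of_ereal (f x))" if "x \<in> ?D" for x
    using that assms by (cases "f x") (auto simp: closed_convex_function_def eff_domain_def)
  have cvx: "convex_on ?D (\<lambda>x. real_of_ereal (f x))"
    using assms by (simp add: closed_convex_function_def)
  have "{x \<in> S. f x \<le> ereal \<delta>} = {x \<in> ?D. real_of_ereal (f x) \<le> \<delta>}"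
  proof (intro equalityI subsetI)
    fix x assume x: "x \<in> {x \<in> S. f x \<le> ereal \<delta>}"
    then have "x \<in> ?D" by (auto simp: eff_domain_def)
    with x fin[of x] show "x \<in> {x \<in> ?D. real_of_ereal (f x) \<le> \<delta>}"
      by (metis (mono_tags, lifting) ereal_less_eq(3) mem_Collect_eq)
  next
    fix x assume x: "x \<in> {x \<in> ?D. real_of_ereal (f x) \<le> \<delta>}"
    with fin[of x] show "x \<in> {x \<in> S. f x \<le> ereal \<delta>}"
      by (metis (mono_tags, lifting) eff_domain_def ereal_less_eq(3) mem_Collect_eq)
  qed
  moreover have "convex {x \<in> ?D. real_of_ereal (f x) \<le> \<delta>}"
  proof (rule convexI)
    fix x y u v :: _
    assume *: "x \<in> {x \<in> ?D. real_of_ereal (f x) \<le> \<delta>}" "y \<in> {x \<in> ?D. real_of_ereal (f x) \<le> \<delta>}"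
      and uv: "0 \<le> (u::real)" "0 \<le> v" "u + v = 1"
    have "u *\<^sub>R x + v *\<^sub>R y \<in> ?D"
      using cvx * uv by (auto simp: convex_on_def convex_def)
    moreover have "real_of_ereal (f (u *\<^sub>R x + v *\<^sub>R y)) \<le>
        u * real_of_ereal (f x) + v * real_of_ereal (f y)"
      using cvx * uv by (auto simp: convex_on_def)
    moreover have "\<dots> \<le> \<delta>"
      using * uv by (intro convex_bound_le) auto
    ultimately show "u *\<^sub>R x + v *\<^sub>R y \<in> {x \<in> ?D. real_of_ereal (f x) \<le> \<delta>}"
      by simp
  qed
  ultimately show ?thesis by simp
qed

text \<open>Fixing the last coordinate at \<open>e\<close> is harmless, since a convex combination
  of \<open>e\<close> with itself is \<open>e\<close>. It is used with \<open>e\<close> equal to 1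
  and 0.\<close>

lemma convex_sublevel_slice:
  assumes "closed_convex_function (S \<times> (UNIV :: real set)) f"
  shows "convex {v \<in> S. f (v, e) \<le> ereal \<delta>}"
proof (rule convexI)
  fix x y and u v :: real
  assume *: "x \<in> {v \<in> S. f (v, e) \<le> ereal \<delta>}" "y \<in> {v \<in> S. f (v, e) \<le> ereal \<delta>}"
    and uv: "0 \<le> u" "0 \<le> v" "u + v = 1"
  have "u *\<^sub>R (x, e) + v *\<^sub>R (y, e) \<in> {x \<in> S \<times> UNIV. f x \<le> ereal \<delta>}"
    using * by (intro convexD[OF convex_sublevel[OF assms] _ _ uv]) auto
  moreover have "u * e + v * e = e"
    using uv by (metis distrib_right mult_1)
  ultimately show "u *\<^sub>R x + v *\<^sub>R y \<in> {v \<in> S. f (v, e) \<le> ereal \<delta>}"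
    by simp
qed

text \<open>The quotient of \<open>w\<close> by \<open>\<tau>\<close> does not change when both are
  multiplied by \<open>\<alpha>\<close>.\<close>

lemma perspective_scale:
  assumes "perspective f w \<tau> \<le> ereal (\<tau> * \<delta>)" and "\<alpha> > 0"
  shows "perspective f (\<alpha> *\<^sub>R w) (\<alpha> * \<tau>) \<le> ereal ((\<alpha> * \<tau>) * \<delta>)"
  using assms unfolding perspective_le_iff by (auto simp: field_simps)

text \<open>The quotient of \<open>v + w\<close> by \<open>\<sigma> + \<tau>\<close> is the convex
  combination of the two given quotients with weights proportional to \<open>\<sigma>\<close> and
  \<open>\<tau>\<close>.\<close>

lemma perspective_add:
  assumes "subspace S" and "convex {v \<in> S. f v \<le> ereal \<delta>}"
    and "v \<in> S" "perspective f v \<sigma> \<le> ereal (\<sigma> * \<delta>)"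
    and "w \<in> S" "perspective f w \<tau> \<le> ereal (\<tau> * \<delta>)"
  shows "perspective f (v + w) (\<sigma> + \<tau>) \<le> ereal ((\<sigma> + \<tau>) * \<delta>)"
proof (cases "\<sigma> > 0 \<and> \<tau> > 0")
  case True
  let ?K = "{v \<in> S. f v \<le> ereal \<delta>}"
  have "v /\<^sub>R \<sigma> \<in> ?K" "w /\<^sub>R \<tau> \<in> ?K"
    using assms True unfolding perspective_le_iff by (auto intro: subspace_scale)
  then have "(\<sigma> / (\<sigma> + \<tau>)) *\<^sub>R (v /\<^sub>R \<sigma>) + (\<tau> / (\<sigma> + \<tau>)) *\<^sub>R (w /\<^sub>R \<tau>) \<in> ?K"
    using True by (intro convexD[OF assms(2)]) (auto simp: add_divide_distrib[symmetric])
  moreover have "(\<sigma> / (\<sigma> + \<tau>)) *\<^sub>R (v /\<^sub>R \<sigma>) + (\<tau> / (\<sigma> + \<tau>)) *\<^sub>R (w /\<^sub>R \<tau>) = (v + w) /\<^sub>R (\<sigma> + \<tau>)"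
    using True by (simp add: scaleR_add_right field_simps)
  ultimately show ?thesis
    using True unfolding perspective_le_iff by auto
next
  \<comment> \<open>A parameter that is not positive must be 0 with zero vector, so the sum is just
    the other pair.\<close>
  case False
  with assms(4,6) show ?thesis unfolding perspective_le_iff by auto
qed

text \<open>The empty sum is covered by the value 0 of the perspective at the origin, and so is an
  infinite \<open>J\<close>, where all sums are 0.\<close>

lemma perspective_sum:
  assumes "subspace S" and "convex {v \<in> S. f v \<le> ereal \<delta>}"
    and "\<And>i. i \<in> J \<Longrightarrow> w i \<in> S"
    and "\<And>i. i \<in> J \<Longrightarrow> perspective f (w i) (\<tau> i) \<le> ereal (\<tau> i * \<delta>)"
  shows "perspective f (\<Sum>i\<in>J. w i) (\<Sum>i\<in>J. \<tau> i) \<le> ereal ((\<Sum>i\<in>J. \<tau> i) * \<delta>)"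
  using assms(3,4)
proof (induction J rule: infinite_finite_induct)
  case (insert i J)
  then show ?case
    using assms(1,2) by (simp add: perspective_add subspace_sum)
qed (simp_all add: perspective_def)

lemma subspace_block_space: "subspace (block_space blk s)"
  by (auto simp: block_space_def subspace_def)

lemma linear_subvec: "linear (subvec blk s)"
  by (rule linearI) (auto simp: subvec_def Finite_Cartesian_Product.vec_eq_iff)

text \<open>The point \<open>(w + z, \<eta>)\<close> is the convex combination, with weights
  \<open>\<eta>\<close> and \<open>1 - \<eta>\<close>, of a sublevel point at height 1 and one at
  height 0.\<close>

lemma perspective_split_imp_le:
  assumes "subspace S" and f: "closed_convex_function (S \<times> UNIV) f"
    and "w \<in> S" "z \<in> S"
    and w: "perspective (\<lambda>v. f (v, 1)) w \<eta> \<le> ereal (\<eta> * \<delta>)"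
    and z: "perspective (\<lambda>v. f (v, 0)) z (1 - \<eta>) \<le> ereal ((1 - \<eta>) * \<delta>)"
  shows "f (w + z, \<eta>) \<le> ereal \<delta>"
proof (cases "0 < \<eta> \<and> \<eta> < 1")
  case True
  let ?K = "{x \<in> S \<times> UNIV. f x \<le> ereal \<delta>}"
  have "(w /\<^sub>R \<eta>, 1) \<in> ?K" "(z /\<^sub>R (1 - \<eta>), 0) \<in> ?K"
    using w z True assms(1,3,4) unfolding perspective_le_iff by (auto intro: subspace_scale)
  then have "\<eta> *\<^sub>R (w /\<^sub>R \<eta>, 1) + (1 - \<eta>) *\<^sub>R (z /\<^sub>R (1 - \<eta>), 0) \<in> ?K"
    using True by (intro convexD[OF convex_sublevel[OF f]]) auto
  with True show ?thesis by simp
next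
  \<comment> \<open>At \<open>\<eta>\<close> equal to 0 or 1 one summand vanishes and the bound on
    the other is the claim; beyond that range one of the bounds has a negative parameter and
    fails.\<close>
  case False
  with w z show ?thesis unfolding perspective_le_iff by auto
qed

lemma per_set_subset_C_set:
  assumes "\<And>s l. l \<in> H s \<Longrightarrow> closed_convex_function (block_space blk s \<times> UNIV) (h l)"
  shows "per_set blk H h \<delta> m A r \<subseteq> C_set blk H h \<delta> m A r"
  unfolding per_set_def C_set_def
  by (clarsimp, metis assms perspective_split_imp_le subspace_block_space)

text \<open>Summing the splittings of the individual points block by block gives a splitting of the
  sum, because the perspective constraints are preserved under addition.\<close>

lemma sum_per_set_in_agg_set:
  assumes "\<And>s l. l \<in> H s \<Longrightarrow> closed_convex_function (block_space blk s \<times> UNIV) (h l)"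
    and per: "\<And>i. i \<in> J \<Longrightarrow> (x i, y i) \<in> per_set blk H h \<delta> m A r"
  shows "(\<Sum>i\<in>J. x i, \<Sum>i\<in>J. y i) \<in> agg_set blk H h \<delta> m A r (card J)"
proof -
  \<comment> \<open>\<open>Q i w z\<close> says that \<open>w\<close> and \<open>z\<close> witness
    the splitting of point \<open>i\<close>; witnesses can then be chosen as functions of
    \<open>i\<close>.\<close>
  define Q where "Q i w z \<longleftrightarrow> (\<forall>s. w s \<in> block_space blk s \<and> z s \<in> block_space blk s \<and>
      subvec blk s (x i) = w s + z s \<and>
      (\<forall>l\<in>H s.
         perspective (\<lambda>v. h l (v, 1)) (w s) (y i $ s) \<le> ereal (y i $ s * \<delta> l) \<and>
         perspective (\<lambda>v. h l (v, 0)) (z s) (1 - y i $ s) \<le> ereal ((1 - y i $ s) * \<delta> l)))"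
    for i w z
  have "\<forall>i\<in>J. \<exists>w z. Q i w z"
    using per unfolding per_set_def Q_def by blast
  then obtain w z where Q: "\<And>i. i \<in> J \<Longrightarrow> Q i (w i) (z i)"
    by metis
  define W Z where "W s = (\<Sum>i\<in>J. w i s)" and "Z s = (\<Sum>i\<in>J. z i s)" for s
  have "A i \<bullet> (\<Sum>j\<in>J. y j) \<le> real (card J) * r i" if "i < m" for i
    unfolding inner_sum_right
    using per that by (intro sum_bounded_above) (auto simp: per_set_def lin_ineqs_def)
  moreover have "W s \<in> block_space blk s \<and> Z s \<in> block_space blk s" for s
    using Q by (auto intro!: subspace_sum[OF subspace_block_space] simp: Q_def W_def Z_def)
  moreover have "subvec blk s (\<Sum>i\<in>J. x i) = W s + Z s" for s
    unfolding W_def Z_def linear_sum[OF linear_subvec] sum.distrib[symmetric]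
    using Q by (intro sum.cong) (auto simp: Q_def)
  moreover have "perspective (\<lambda>v. h l (v, 1)) (W s) ((\<Sum>i\<in>J. y i) $ s)
      \<le> ereal ((\<Sum>i\<in>J. y i) $ s * \<delta> l)" if "l \<in> H s" for s l
    unfolding W_def sum_component using Q that
    by (intro perspective_sum[OF subspace_block_space convex_sublevel_slice[OF assms(1)]])
      (auto simp: Q_def)
  moreover have "perspective (\<lambda>v. h l (v, 0)) (Z s) (real (card J) - (\<Sum>i\<in>J. y i) $ s)
      \<le> ereal ((real (card J) - (\<Sum>i\<in>J. y i) $ s) * \<delta> l)" if "l \<in> H s" for s l
  proof -
    \<comment> \<open>Distributing \<open>card J\<close> as one unit per member turns the parameter
      into a sum over \<open>J\<close>, the form that \<open>perspective_sum\<close>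
      expects.\<close>
    have eq: "real (card J) - (\<Sum>i\<in>J. y i) $ s = (\<Sum>i\<in>J. 1 - y i $ s)"
      by (simp add: sum_subtractf)
    show ?thesis
      unfolding Z_def eq using Q that
      by (intro perspective_sum[OF subspace_block_space convex_sublevel_slice[OF assms(1)]])
        (auto simp: Q_def)
  qed
  ultimately show ?thesis
    unfolding agg_set_def lin_ineqs_def by blast
qed

text \<open>Scaling an aggregate splitting by \<open>1 / N\<close> gives a splitting of the average,
  with the parameter \<open>N - Y $ s\<close> turning into 1 minus the averaged entry.\<close>

lemma average_agg_set_in_per_set:
  assumes "N > 0" and "(X, Y) \<in> agg_set blk H h \<delta> m A r N"
  shows "(X /\<^sub>R real N, Y /\<^sub>R real N) \<in> per_set blk H h \<delta> m A r"
proof -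
  obtain W Z where WZ: "\<And>s. W s \<in> block_space blk s" "\<And>s. Z s \<in> block_space blk s"
      "\<And>s. subvec blk s X = W s + Z s"
    and W: "\<And>s l. l \<in> H s \<Longrightarrow> perspective (\<lambda>v. h l (v, 1)) (W s) (Y $ s) \<le> ereal (Y $ s * \<delta> l)"
    and Z: "\<And>s l. l \<in> H s \<Longrightarrow> perspective (\<lambda>v. h l (v, 0)) (Z s) (real N - Y $ s)
        \<le> ereal ((real N - Y $ s) * \<delta> l)"
    and Y: "Y \<in> lin_ineqs m A (\<lambda>i. real N * r i)"
    using assms(2) unfolding agg_set_def by auto
  define w z where "w s = W s /\<^sub>R real N" and "z s = Z s /\<^sub>R real N" for s
  have "Y /\<^sub>R real N \<in> lin_ineqs m A r"
    using Y assms(1) by (auto simp: lin_ineqs_def field_simps)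
  moreover have "w s \<in> block_space blk s \<and> z s \<in> block_space blk s" for s
    using WZ by (simp add: w_def z_def subspace_scale subspace_block_space)
  moreover have "subvec blk s (X /\<^sub>R real N) = w s + z s" for s
    by (simp add: w_def z_def linear_scale[OF linear_subvec] WZ scaleR_add_right)
  moreover have "perspective (\<lambda>v. h l (v, 1)) (w s) ((Y /\<^sub>R real N) $ s)
      \<le> ereal ((Y /\<^sub>R real N) $ s * \<delta> l)" if "l \<in> H s" for s l
    using perspective_scale[OF W[OF that], of "inverse (real N)"] assms(1) by (simp add: w_def)
  moreover have "perspective (\<lambda>v. h l (v, 0)) (z s) (1 - (Y /\<^sub>R real N) $ s)
      \<le> ereal ((1 - (Y /\<^sub>R real N) $ s) * \<delta> l)" if "l \<in> H s" for s l
  proof -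
    have "inverse (real N) * (real N - Y $ s) = 1 - (Y /\<^sub>R real N) $ s"
      using assms(1) by (simp add: right_diff_distrib)
    then show ?thesis
      using perspective_scale[OF Z[OF that], of "inverse (real N)"] assms(1) by (simp add: z_def)
  qed
  ultimately show ?thesis
    unfolding per_set_def by blast
qed

lemma LB_individual_antimono:
  assumes "\<And>t. t \<in> {1..T} \<Longrightarrow> S t \<subseteq> S' t"
  shows "LB_individual T I L c a b S' \<le> LB_individual T I L c a b S"
  unfolding LB_individual_def
  by (rule Inf_superset_mono) (use assms in blast)

text \<open>By linearity of the inner product, the group sums have the same objective and the same
  linking values as the individual solution.\<close>

lemma LB_aggregate_le_individual:
  assumes "\<And>t x y. t \<in> {1..T} \<Longrightarrow> (\<And>i. i \<in> I t \<Longrightarrow> (x i, y i) \<in> S t) \<Longrightarrow>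
    (\<Sum>i\<in>I t. x i, \<Sum>i\<in>I t. y i) \<in> S' t"
  shows "LB_aggregate T L c a b S' \<le> LB_individual T I L c a b S"
  unfolding LB_individual_def
proof (rule Inf_greatest, clarify)
  fix x y
  assume "\<forall>l\<in>L. (\<Sum>t=1..T. \<Sum>i\<in>I t. a t l \<bullet> x i) \<le> b l"
    and "\<forall>t\<in>{1..T}. \<forall>i\<in>I t. (x i, y i) \<in> S t"
  then show "LB_aggregate T L c a b S' \<le> ereal (\<Sum>t=1..T. \<Sum>i\<in>I t. c t \<bullet> x i)"
    unfolding LB_aggregate_def inner_sum_right[symmetric]
    by (intro Inf_lower CollectI exI[of _ "\<lambda>t. \<Sum>i\<in>I t. x i"] exI[of _ "\<lambda>t. \<Sum>i\<in>I t. y i"])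
      (use assms in auto)
qed

text \<open>Every member of a group receives the group average, which leaves the objective and the
  linking values unchanged.\<close>

lemma LB_individual_le_aggregate:
  assumes "disjoint_family_on I {1..T}"
    and "\<And>t. t \<in> {1..T} \<Longrightarrow> card (I t) > 0"
    and "\<And>t X Y. t \<in> {1..T} \<Longrightarrow> (X, Y) \<in> S' t \<Longrightarrow>
      (X /\<^sub>R real (card (I t)), Y /\<^sub>R real (card (I t))) \<in> S t"
  shows "LB_individual T I L c a b S \<le> LB_aggregate T L c a b S'"
  unfolding LB_aggregate_def
proof (rule Inf_greatest, clarify)
  fix X Y
  assume lin: "\<forall>l\<in>L. (\<Sum>t=1..T. a t l \<bullet> X t) \<le> b l"
    and mem: "\<forall>t\<in>{1..T}. (X t, Y t) \<in> S' t"
  \<comment> \<open>The individual variables depend on \<open>i\<close> alone, so the group has to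
    be recovered from \<open>i\<close>; disjointness makes it unique.\<close>
  define grp where "grp i = (THE t. t \<in> {1..T} \<and> i \<in> I t)" for i
  have grp: "grp i = t" if "t \<in> {1..T}" "i \<in> I t" for i t
    unfolding grp_def
    by (rule the_equality) (use assms(1) that in \<open>unfold disjoint_family_on_def, blast+\<close>)
  define x where "x i = X (grp i) /\<^sub>R real (card (I (grp i)))" for i
  define y where "y i = Y (grp i) /\<^sub>R real (card (I (grp i)))" for i
  \<comment> \<open>\<open>card (I t)\<close> equal copies of the average add up to
    \<open>X t\<close>; positivity of the cardinality is essential here.\<close>
  have sum_x: "(\<Sum>i\<in>I t. v \<bullet> x i) = v \<bullet> X t" if "t \<in> {1..T}" for t v
  proof -
    have "(\<Sum>i\<in>I t. v \<bullet> x i) = (\<Sum>i\<in>I t. v \<bullet> (X t /\<^sub>R real (card (I t))))"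
      using grp[OF that] by (intro sum.cong) (auto simp: x_def)
    then show ?thesis using assms(2)[OF that] by simp
  qed
  have lin': "\<forall>l\<in>L. (\<Sum>t=1..T. \<Sum>i\<in>I t. a t l \<bullet> x i) \<le> b l"
    using lin by (simp add: sum_x)
  have mem': "\<forall>t\<in>{1..T}. \<forall>i\<in>I t. (x i, y i) \<in> S t"
    using mem assms(3) grp by (simp add: x_def y_def)
  have "ereal (\<Sum>t=1..T. c t \<bullet> X t) = ereal (\<Sum>t=1..T. \<Sum>i\<in>I t. c t \<bullet> x i)"
    by (simp add: sum_x)
  with lin' mem' show "LB_individual T I L c a b S \<le> ereal (\<Sum>t=1..T. c t \<bullet> X t)"
    unfolding LB_individual_def by (intro Inf_lower) blast
qed

theorem theorem4:
  fixes T :: nat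
    and I :: "nat \<Rightarrow> 'i set"
    and L :: "'l set"
    and c :: "nat \<Rightarrow> real ^ 'd"
    and a :: "nat \<Rightarrow> 'l \<Rightarrow> real ^ 'd"
    and b :: "'l \<Rightarrow> real"
    and blk :: "'d::finite \<Rightarrow> 'k::finite"
    and H :: "nat \<Rightarrow> 'k \<Rightarrow> 'm set"
    and h :: "nat \<Rightarrow> 'm \<Rightarrow> (real ^ 'd) \<times> real \<Rightarrow> ereal"
    and \<delta> :: "nat \<Rightarrow> 'm \<Rightarrow> real"
    and m :: "nat \<Rightarrow> nat"
    and A :: "nat \<Rightarrow> nat \<Rightarrow> real ^ 'k"
    and r :: "nat \<Rightarrow> nat \<Rightarrow> real"
  assumes "finite (\<Union>t\<in>{1..T}. I t)"
    and "\<And>t. t \<in> {1..T} \<Longrightarrow> I t \<noteq> {}"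
    and "disjoint_family_on I {1..T}"
    and "finite L"
    and "\<And>t s. t \<in> {1..T} \<Longrightarrow> finite (H t s)"
    and "\<And>t s l. t \<in> {1..T} \<Longrightarrow> l \<in> H t s \<Longrightarrow>
           closed_convex_function (block_space blk s \<times> UNIV) (h t l)"
    and "\<And>t. t \<in> {1..T} \<Longrightarrow> totally_unimodular (m t) (A t)"
    and "\<And>t i. t \<in> {1..T} \<Longrightarrow> i < m t \<Longrightarrow> r t i \<in> \<int>"
    and "\<And>t. t \<in> {1..T} \<Longrightarrow> lin_ineqs (m t) (A t) (r t) \<subseteq> {y. \<forall>s. 0 \<le> y $ s \<and> y $ s \<le> 1}"
    and "\<And>t. t \<in> {1..T} \<Longrightarrow>
           bounded (Omega_set blk (H t) (h t) (\<delta> t) (m t) (A t) (r t))"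
  shows "LB_P_agg T I L c a b blk H h \<delta> m A r = LB_P_per T I L c a b blk H h \<delta> m A r \<and>
         LB_P_per T I L c a b blk H h \<delta> m A r \<ge> LB_P0 T I L c a b blk H h \<delta> m A r"
proof
  have card: "card (I t) > 0" if "t \<in> {1..T}" for t
    using assms(1,2) that by (auto simp: card_gt_0_iff)
  show "LB_P_agg T I L c a b blk H h \<delta> m A r = LB_P_per T I L c a b blk H h \<delta> m A r"
    unfolding LB_P_agg_def LB_P_per_def
    \<comment> \<open>Summing within groups gives one inequality, averaging gives the other.\<close>
    by (intro antisym LB_aggregate_le_individual LB_individual_le_aggregate
        sum_per_set_in_agg_set average_agg_set_in_per_set assms(3,6) card)
  show "LB_P_per T I L c a b blk H h \<delta> m A r \<ge> LB_P0 T I L c a b blk H h \<delta> m A r"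
    unfolding LB_P0_def LB_P_per_def
    by (intro LB_individual_antimono per_set_subset_C_set assms(6))
qed

end
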